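(* Let $L$ be a non-characteristically nilpotent filiform Leibniz algebra from the family $F_2(\beta_3,\beta_4,\dots,\beta_n,\gamma)$. If $\gamma=0$, then $L$ is isomorphic to one of the following pairwise non-isomorphic algebras: $$F_2^j(0,\dots,0,\overset{j}{1},0,\dots,0,0),\qquad 3\le j\le n,$$ where $F_2^j(0,\dots,0,\overset{j}{1},0,\dots,0,0)$ denotes the algebra $F_2(\beta_3,\dots,\beta_n,\gamma)$ with $\beta_j=1$, $\beta_k=0$ for all $k\neq j$, and $\gamma=0$.
   Context: A Leibniz algebra is a vector space with a bilinear bracket satisfying $[[x,y],z]=[[x,z],y]+[x,[y,z]]$. A derivation of a Leibniz algebra $L$ is a linear map $d:L\to L$ with $d([x,y])=[d(x),y]+[x,d(y)]$. With $L^1=L$, $L^{k+1}=[L^k,L]$, $L$ is nilpotent if $L^m=0$ for some $m$, and an algebra $L$ of dimension $N$ is filiform if $\dim L^i=N-i$ for $2\le i\le N$. A nilpotent Leibniz algebra is characteristically nilpotent if all its derivations are nilpotent linear maps, and non-characteristically nilpotent if it is nilpotent but admits a non-nilpotent derivation. For complex parameters, $F_2(\beta_3,\dots,\beta_n,\gamma)$ denotes the $(n+1)$-dimensional complex filiform Leibniz algebra with basis $\{e_0,e_1,\dots,e_n\}$ and products $[e_0,e_0]=e_2$; $[e_i,e_0]=e_{i+1}$ for $2\le i\le n-1$; $[e_0,e_1]=\sum_{k=3}^n\beta_ke_k$; $[e_1,e_1]=\gamma e_n$; $[e_i,e_1]=\sum_{k=i+2}^n\beta_{k+1-i}e_k$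 for $2\le i\le n-2$; all other products of basis elements are zero.
   Formalization: The formal theorem assumes n≥3 and that β_3,…,β_n are not all zero: F_2(0,…,0,0) satisfies every hypothesis (derivation diag(1,1,2,…,n)), but e_1 lies in its two-sided annihilator and outside [L,L], so it is isomorphic to no F_2^j. *)

theory Defs
  imports Complex_Main "HOL-Library.Function_Algebras"
begin

(* An algebra lives on a subspace L of an ambient complex vector space; maps on L are
   HOL functions on the ambient type whose values outside L are irrelevant. *)
locale complex_algebra = vector_space scale
  for scale :: "complex \<Rightarrow> 'a::ab_group_add \<Rightarrow> 'a" +
  fixes L :: "'a set" and br :: "'a \<Rightarrow> 'a \<Rightarrow> 'a"
  assumes subspace_L: "subspace L"
    and br_closed: "x \<in> L \<Longrightarrow> y \<in> L \<Longrightarrow> br x y \<in> L"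
    and br_add_left: "x \<in> L \<Longrightarrow> y \<in> L \<Longrightarrow> z \<in> L \<Longrightarrow> br (x + y) z = br x z + br y z"
    and br_add_right: "x \<in> L \<Longrightarrow> y \<in> L \<Longrightarrow> z \<in> L \<Longrightarrow> br x (y + z) = br x y + br x z"
    and br_scale_left: "x \<in> L \<Longrightarrow> y \<in> L \<Longrightarrow> br (scale c x) y = scale c (br x y)"
    and br_scale_right: "x \<in> L \<Longrightarrow> y \<in> L \<Longrightarrow> br x (scale c y) = scale c (br x y)"
begin

(* lcs k is L^k of the series L^1 = L, L^(k+1) = [L^k, L]; the index 0 is not used. *)
fun lcs :: "nat \<Rightarrow> 'a set" where
  "lcs 0 = L"
| "lcs (Suc 0) = L"
| "lcs (Suc (Suc k)) = span {br x y | x y. x \<in> lcs (Suc k) \<and> y \<in> L}"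

definition nilpotent :: bool where
  "nilpotent \<longleftrightarrow> (\<exists>m\<ge>1. lcs m = {0})"

(* The library's dim is 0 on infinite-dimensional spaces, hence the first conjunct. *)
definition filiform :: bool where
  "filiform \<longleftrightarrow> (\<exists>B. finite B \<and> L \<subseteq> span B) \<and> (\<forall>i. 2 \<le> i \<and> i \<le> dim L \<longrightarrow> dim (lcs i) = dim L - i)"

definition derivation :: "('a \<Rightarrow> 'a) \<Rightarrow> bool" where
  "derivation d \<longleftrightarrow>
     (\<forall>x\<in>L. d x \<in> L) \<and>
     (\<forall>x\<in>L. \<forall>y\<in>L. d (x + y) = d x + d y) \<and>
     (\<forall>c. \<forall>x\<in>L. d (scale c x) = scale c (d x)) \<and>
     (\<forall>x\<in>L. \<forall>y\<in>L. d (br x y) = br (d x) y + br x (d y))"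

definition nilpotent_map :: "('a \<Rightarrow> 'a) \<Rightarrow> bool" where
  "nilpotent_map d \<longleftrightarrow> (\<exists>m. \<forall>x\<in>L. (d ^^ m) x = 0)"

definition non_char_nilpotent :: bool where
  "non_char_nilpotent \<longleftrightarrow> nilpotent \<and> (\<exists>d. derivation d \<and> \<not> nilpotent_map d)"

end

locale leibniz_algebra = complex_algebra scale L br
  for scale :: "complex \<Rightarrow> 'a::ab_group_add \<Rightarrow> 'a" and L br +
  assumes leibniz: "x \<in> L \<Longrightarrow> y \<in> L \<Longrightarrow> z \<in> L \<Longrightarrow> br (br x y) z = br (br x z) y + br x (br y z)"

definition alg_iso ::
  "(complex \<Rightarrow> 'a::ab_group_add \<Rightarrow> 'a) \<Rightarrow> 'a set \<Rightarrow> ('a \<Rightarrow> 'a \<Rightarrow> 'a) \<Rightarrow>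
   (complex \<Rightarrow> 'b::ab_group_add \<Rightarrow> 'b) \<Rightarrow> 'b set \<Rightarrow> ('b \<Rightarrow> 'b \<Rightarrow> 'b) \<Rightarrow> bool" where
  "alg_iso s L b s' L' b' \<longleftrightarrow>
     (\<exists>f. bij_betw f L L' \<and>
          (\<forall>x\<in>L. \<forall>y\<in>L. f (x + y) = f x + f y) \<and>
          (\<forall>c. \<forall>x\<in>L. f (s c x) = s' c (f x)) \<and>
          (\<forall>x\<in>L. \<forall>y\<in>L. f (b x y) = b' (f x) (f y)))"

(* Coordinate model of the (n+1)-dimensional space with basis e_0, ..., e_n:
   v is the vector with i-th coordinate v i. *)
definition coord_scale :: "complex \<Rightarrow> (nat \<Rightarrow> complex) \<Rightarrow> nat \<Rightarrow> complex" where
  "coord_scale c v = (\<lambda>k. c * v k)"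

definition coord_space :: "nat \<Rightarrow> (nat \<Rightarrow> complex) set" where
  "coord_space n = {v. \<forall>i>n. v i = 0}"

definition bas :: "nat \<Rightarrow> nat \<Rightarrow> complex" where
  "bas i = (\<lambda>k. if k = i then 1 else 0)"

(* F2_prod n \<beta> \<gamma> i j is [e_i, e_j] in F_2(\<beta> 3, ..., \<beta> n, \<gamma>); values of \<beta> outside 3..n are not used. *)
definition F2_prod :: "nat \<Rightarrow> (nat \<Rightarrow> complex) \<Rightarrow> complex \<Rightarrow> nat \<Rightarrow> nat \<Rightarrow> nat \<Rightarrow> complex" where
  "F2_prod n \<beta> \<gamma> i j =
     (if i = 0 \<and> j = 0 then bas 2
      else if 2 \<le> i \<and> i \<le> n - 1 \<and> j = 0 then bas (i + 1)
      else if i = 0 \<and> j = 1 then (\<Sum>k=3..n. coord_scale (\<beta> k) (bas k))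
      else if i = 1 \<and> j = 1 then coord_scale \<gamma> (bas n)
      else if 2 \<le> i \<and> i \<le> n - 2 \<and> j = 1 then (\<Sum>k=i+2..n. coord_scale (\<beta> (k + 1 - i)) (bas k))
      else 0)"

definition F2_br :: "nat \<Rightarrow> (nat \<Rightarrow> complex) \<Rightarrow> complex \<Rightarrow>
    (nat \<Rightarrow> complex) \<Rightarrow> (nat \<Rightarrow> complex) \<Rightarrow> nat \<Rightarrow> complex" where
  "F2_br n \<beta> \<gamma> x y = (\<Sum>i\<le>n. \<Sum>j\<le>n. coord_scale (x i * y j) (F2_prod n \<beta> \<gamma> i j))"

definition F2j_br :: "nat \<Rightarrow> nat \<Rightarrow> (nat \<Rightarrow> complex) \<Rightarrow> (nat \<Rightarrow> complex) \<Rightarrow> nat \<Rightarrow> complex" where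
  "F2j_br n j = F2_br n (\<lambda>k. if k = j then 1 else 0) 0"

(* F_2(0, ..., 0, 0) is filiform, nilpotent and has the diagonal derivation with weights
   1, 1, 2, ..., n, but it is the split algebra in which e_1 annihilates everything on both
   sides without lying in [L, L]; no F_2^j has such an element (its two-sided annihilator is
   spanned by e_n). A classification by the algebras F_2^j therefore has to exclude
   the parameter tuple zero. *)

end

theory Submission
  imports Defs "HOL-Computational_Algebra.Formal_Power_Series"
begin

text \<open>
  For \<open>\<gamma> = 0\<close> the algebra is \<open>A \<oplus> \<complex> e\<^sub>1\<close> with \<open>A = \<complex>[t]/(t\<^sup>n)\<close> and
  \<open>[f + a e\<^sub>1, g + b e\<^sub>1] = (g(0) t + b p) f\<close>, where \<open>p\<close> is the sum of the \<open>\<beta>\<^sub>k t\<^bsup>k-1\<^esup>\<close>. A derivation with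
  \<open>d e\<^sub>0 = u + a e\<^sub>1\<close> and \<open>d e\<^sub>1 = v + b e\<^sub>1\<close> forces \<open>p' (u(0) t + a p) = b p\<close>. If \<open>p\<close> has order \<open>m\<close>, then
  \<open>b = m u(0)\<close>, so a derivation that is not nilpotent has \<open>u(0) \<noteq> 0\<close>. The differential equation then says that
  \<open>p = c T\<^sup>m\<close> for a new parameter \<open>T = t + \<alpha> p\<close>, which is right multiplication by \<open>e\<^sub>0 + \<alpha> e\<^sub>1\<close>; substituting \<open>T\<close>
  for \<open>t\<close> and rescaling \<open>e\<^sub>1\<close> is an isomorphism with the algebra of \<open>p = t\<^sup>m\<close>. Different orders give non-isomorphic
  algebras, because \<open>e\<^sub>1\<close> is determined up to scaling and multiples of \<open>e\<^sub>n\<close> by \<open>[e\<^sub>1, L] = 0\<close>.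
\<close>

unbundle fps_syntax

subsection \<open>Power series coordinates\<close>

text \<open>
  The vector \<open>vec n f a\<close> stands for \<open>f + a e\<^sub>1\<close>, where a power series \<open>f\<close>, taken modulo \<open>t\<^sup>n\<close>,
  is read in the basis \<open>e\<^sub>0 = 1\<close>, \<open>e\<^sub>2 = t\<close>, \<open>e\<^sub>3 = t\<^sup>2\<close>, and so on; \<open>ser\<close> recovers \<open>f\<close>. The series \<open>act \<beta>\<close> is the
  \<open>p\<close> by which right multiplication by \<open>e\<^sub>1\<close> acts. Congruence modulo \<open>t\<^sup>n\<close> is written as divisibility.
\<close>

definition ser :: "(nat \<Rightarrow> complex) \<Rightarrow> complex fps" where
  "ser x = Abs_fps (\<lambda>k. if k = 0 then x 0 else x (Suc k))"

definition vec :: "nat \<Rightarrow> complex fps \<Rightarrow> complex \<Rightarrow> nat \<Rightarrow> complex" where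
  "vec n f a = (\<lambda>k. if k = 0 then f $ 0 else if k = 1 then a else if k \<le> n then f $ (k - 1) else 0)"

definition act :: "(nat \<Rightarrow> complex) \<Rightarrow> complex fps" where
  "act \<beta> = Abs_fps (\<lambda>k. if k < 2 then 0 else \<beta> (Suc k))"

lemma fps_X_power_dvd_iff:
  fixes f :: "'a::comm_ring_1 fps"
  shows "fps_X ^ n dvd f \<longleftrightarrow> (\<forall>k<n. f $ k = 0)"
proof
  assume "fps_X ^ n dvd f"
  then obtain g where "f = fps_X ^ n * g" ..
  then show "\<forall>k<n. f $ k = 0"
    by (simp add: fps_X_power_mult_nth)
next
  assume "\<forall>k<n. f $ k = 0"
  then have "f = fps_X ^ n * fps_shift n f"
    by (auto simp: fps_eq_iff fps_X_power_mult_nth)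
  then show "fps_X ^ n dvd f" ..
qed

lemma vec_eq_iff:
  assumes "n \<ge> 1"
  shows "vec n f a = vec n g b \<longleftrightarrow> a = b \<and> fps_X ^ n dvd f - g"
proof
  assume eq: "vec n f a = vec n g b"
  have "f $ k = g $ k" if "k < n" for k
    using fun_cong[OF eq, of "if k = 0 then 0 else Suc k"] that
    by (auto simp: vec_def split: if_splits)
  moreover have "a = b"
    using fun_cong[OF eq, of 1] by (simp add: vec_def)
  ultimately show "a = b \<and> fps_X ^ n dvd f - g"
    by (simp add: fps_X_power_dvd_iff)
qed (use assms in \<open>auto simp: vec_def fps_X_power_dvd_iff fun_eq_iff\<close>)

lemma vec_cong:
  assumes "n \<ge> 1" "fps_X ^ n dvd f - g" "a = b"
  shows "vec n f a = vec n g b"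
  using assms vec_eq_iff by blast

lemma vec_ser: "x \<in> coord_space n \<Longrightarrow> vec n (ser x) (x 1) = x"
  by (auto simp: vec_def ser_def coord_space_def fun_eq_iff)

lemma ser_vec: "fps_X ^ n dvd ser (vec n f a) - f"
  by (auto simp: vec_def ser_def fps_X_power_dvd_iff)

lemma vec_nth_0 [simp]: "vec n f a 0 = f $ 0"
  and vec_nth_1 [simp]: "vec n f a (Suc 0) = a"
  by (simp_all add: vec_def)

lemma ser_nth_0 [simp]: "ser x $ 0 = x 0"
  by (simp add: ser_def)

lemma act_nth_0 [simp]: "act \<beta> $ 0 = 0"
  and act_nth_1 [simp]: "act \<beta> $ Suc 0 = 0"
  by (simp_all add: act_def)

lemma vec_in_space: "n \<ge> 1 \<Longrightarrow> vec n f a \<in> coord_space n"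
  by (auto simp: vec_def coord_space_def)

lemma vec_add: "vec n f a + vec n g b = vec n (f + g) (a + b)"
  by (auto simp: vec_def fun_eq_iff)

lemma vec_scale: "coord_scale c (vec n f a) = vec n (fps_const c * f) (c * a)"
  by (auto simp: vec_def fun_eq_iff coord_scale_def)

lemma vec_0: "vec n 0 0 = 0"
  by (auto simp: vec_def fun_eq_iff)

lemma coord_scale_0 [simp]: "coord_scale 0 x = 0"
  by (simp add: coord_scale_def fun_eq_iff)

lemma ser_add: "ser (x + y) = ser x + ser y"
  by (auto simp: ser_def fps_eq_iff)

lemma ser_scale: "ser (coord_scale c x) = fps_const c * ser x"
  by (auto simp: ser_def fps_eq_iff coord_scale_def)

section \<open>The bracket as multiplication of power series\<close>

lemma sum_bas: "(\<Sum>k=a..b. coord_scale (c k) (bas k)) m = (if a \<le> m \<and> m \<le> b then c m else 0)"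
proof -
  have "(\<Sum>k=a..b. coord_scale (c k) (bas k)) m = (\<Sum>k=a..b. coord_scale (c k) (bas k) m)"
    by (induction rule: infinite_finite_induct) auto
  also have "\<dots> = (\<Sum>k=a..b. if m = k then c k else 0)"
    by (intro sum.cong) (auto simp: coord_scale_def bas_def)
  finally show ?thesis
    by (simp add: sum.delta)
qed

lemma F2_prod_0:
  assumes "n \<ge> 3"
  shows "F2_prod n \<beta> 0 i 0 k =
    (if i = 0 \<and> k = 2 \<or> 2 \<le> i \<and> k = Suc i \<and> k \<le> n then 1 else 0)"
  using assms by (auto simp: F2_prod_def bas_def)

text \<open>\<open>act \<beta>\<close> vanishes in degrees 0 and 1, so the range k >= i + 2 of the
  products can be relaxed to k >= i, and the rows i = n - 1 and i = n fit the same formula.\<close>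

lemma F2_prod_1:
  assumes "n \<ge> 3" "i \<le> n"
  shows "F2_prod n \<beta> 0 i 1 k =
    (if k \<le> n \<and> (i = 0 \<or> 2 \<le> i \<and> i \<le> k) then act \<beta> $ (k - (if i = 0 then 1 else i)) else 0)"
proof -
  consider "i = 0" | "i = 1" | "2 \<le> i" "i \<le> n - 2" | "2 \<le> i" "n - 2 < i" by linarith
  then show ?thesis
  proof cases
    case 2 then show ?thesis using assms
      by (simp add: F2_prod_def coord_scale_def)
  next
    case 1 then show ?thesis using assms
      by (auto simp: F2_prod_def sum_bas act_def)
  next
    case 3 then show ?thesis using assms
      by (auto simp: F2_prod_def sum_bas act_def Suc_diff_le)
  next
    case 4 then show ?thesis using assms
      by (auto simp: F2_prod_def act_def)
  qed
qed

lemma F2_br_nth: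
  assumes "n \<ge> 3"
  shows "F2_br n \<beta> 0 x y k =
    y 0 * (\<Sum>i\<le>n. x i * F2_prod n \<beta> 0 i 0 k) + y 1 * (\<Sum>i\<le>n. x i * F2_prod n \<beta> 0 i 1 k)"
proof -
  have app: "(\<Sum>i\<in>A. f i) k = (\<Sum>i\<in>A. f i k)" for f :: "nat \<Rightarrow> nat \<Rightarrow> complex" and A
    by (induction A rule: infinite_finite_induct) auto
  have "(\<Sum>j\<le>n. coord_scale (x i * y j) (F2_prod n \<beta> 0 i j)) k =
     x i * y 0 * F2_prod n \<beta> 0 i 0 k + x i * y 1 * F2_prod n \<beta> 0 i 1 k" for i
  proof -
    have "(\<Sum>j\<le>n. coord_scale (x i * y j) (F2_prod n \<beta> 0 i j)) k =
        (\<Sum>j\<le>n. x i * y j * F2_prod n \<beta> 0 i j k)"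
      by (simp add: app coord_scale_def)
    also have "\<dots> = (\<Sum>j\<in>{0, 1}. x i * y j * F2_prod n \<beta> 0 i j k)"
      using assms by (intro sum.mono_neutral_right) (auto simp: F2_prod_def)
    finally show ?thesis by simp
  qed
  then show ?thesis
    by (simp add: F2_br_def app sum.distrib sum_distrib_left ac_simps)
qed

lemma sum_F2_prod_0:
  assumes "n \<ge> 3"
  shows "(\<Sum>i\<le>n. x i * F2_prod n \<beta> 0 i 0 k) = vec n (fps_X * ser x) 0 k"
proof (cases "2 \<le> k \<and> k \<le> n")
  case True
  \<comment> \<open>The only index with [e_i, e_0] = e_k; it jumps from 0 to 2 because e_1 is not a
    power of t.\<close>
  let ?i = "if k = 2 then 0 else k - 1"
  have "(\<Sum>i\<le>n. x i * F2_prod n \<beta> 0 i 0 k) = (\<Sum>i\<le>n. if i = ?i then x i else 0)"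
    unfolding F2_prod_0[OF assms] using True by (intro sum.cong) auto
  also have "\<dots> = x ?i"
    using True by (subst sum.delta) auto
  finally show ?thesis
    using True by (auto simp: vec_def ser_def intro!: arg_cong[of _ _ x])
next
  case False
  then have "x i * F2_prod n \<beta> 0 i 0 k = 0" for i
    unfolding F2_prod_0[OF assms] using assms by auto
  then have "(\<Sum>i\<le>n. x i * F2_prod n \<beta> 0 i 0 k) = 0"
    by (intro sum.neutral) auto
  then show ?thesis
    using False assms by (auto simp: vec_def)
qed

lemma sum_F2_prod_1:
  assumes "n \<ge> 3"
  shows "(\<Sum>i\<le>n. x i * F2_prod n \<beta> 0 i 1 k) = vec n (act \<beta> * ser x) 0 k"
proof (cases "2 \<le> k \<and> k \<le> n")
  case True
  then obtain m where k: "k = Suc m" and m: "1 \<le> m" "m < n"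
    by (cases k) auto
  \<comment> \<open>Index 1 is absent because [e_1, e_1] = 0. Closing this gap by a shift of the
    indices from 2 on gives a Cauchy product.\<close>
  have "(\<Sum>i\<le>n. x i * F2_prod n \<beta> 0 i 1 k) =
      (\<Sum>i\<in>insert 0 {2..k}. x i * act \<beta> $ (k - (if i = 0 then 1 else i)))"
    using True by (intro sum.mono_neutral_cong_right) (auto simp: F2_prod_1[OF assms] simp del: One_nat_def)
  also have "\<dots> = x 0 * act \<beta> $ m + (\<Sum>i=Suc 1..Suc m. x i * act \<beta> $ (k - i))"
    unfolding k by (subst sum.insert) (auto simp: numeral_2_eq_2 intro!: sum.cong)
  also have "\<dots> = ser x $ 0 * act \<beta> $ m + (\<Sum>i=1..m. ser x $ i * act \<beta> $ (m - i))"
    unfolding k sum.shift_bounds_cl_Suc_ivl by (auto simp: ser_def intro!: sum.cong)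
  also have "\<dots> = (ser x * act \<beta>) $ m"
    by (simp add: fps_mult_nth sum.atLeast_Suc_atMost)
  finally show ?thesis
    using k m by (simp add: vec_def mult.commute)
next
  case False
  then have "x i * F2_prod n \<beta> 0 i 1 k = 0" if "i \<le> n" for i
    unfolding F2_prod_1[OF assms that] using assms by (auto simp: act_def)
  then have "(\<Sum>i\<le>n. x i * F2_prod n \<beta> 0 i 1 k) = 0"
    by (intro sum.neutral) auto
  then show ?thesis
    using False assms by (auto simp: vec_def)
qed

text \<open>With \<gamma> = 0 a left factor e_1 gives zero, so the left argument enters only through
  \<open>ser x\<close>; on the right only e_0 and e_1 act, by t and by
  \<open>act \<beta>\<close>.\<close>

lemma F2_br_eq_vec:
  assumes "n \<ge> 3"
  shows "F2_br n \<beta> 0 x y = vec n ((fps_const (y 0) * fps_X + fps_const (y 1) * act \<beta>) * ser x) 0"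
  unfolding fun_eq_iff F2_br_nth[OF assms] sum_F2_prod_0[OF assms] sum_F2_prod_1[OF assms]
  by (auto simp: vec_def distrib_right mult.assoc)

lemma F2_br_vec:
  assumes "n \<ge> 3"
  shows "F2_br n \<beta> 0 (vec n f a) (vec n g b) =
    vec n ((fps_const (g $ 0) * fps_X + fps_const b * act \<beta>) * f) 0"
proof -
  have "fps_X ^ n dvd (fps_const (g $ 0) * fps_X + fps_const b * act \<beta>) * (ser (vec n f a) - f)"
    using ser_vec by (rule dvd_mult)
  then show ?thesis
    using assms by (simp add: F2_br_eq_vec vec_eq_iff algebra_simps)
qed

lemma coord_space_cases:
  assumes "x \<in> coord_space n"
  obtains f a where "x = vec n f a"
  using vec_ser[OF assms] by metis

lemma act_single:
  assumes "3 \<le> j"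
  shows "act (\<lambda>k. if k = j then 1 else 0) = fps_X ^ (j - 1)"
  using assms by (auto simp: act_def fps_eq_iff)

subsection \<open>Algebra isomorphisms\<close>

lemma alg_iso_sym:
  assumes iso: "alg_iso s L b s' L' b'"
    and add: "\<And>x y. x \<in> L \<Longrightarrow> y \<in> L \<Longrightarrow> x + y \<in> L"
    and scale: "\<And>c x. x \<in> L \<Longrightarrow> s c x \<in> L"
    and br: "\<And>x y. x \<in> L \<Longrightarrow> y \<in> L \<Longrightarrow> b x y \<in> L"
  shows "alg_iso s' L' b' s L b"
proof -
  obtain f where f: "bij_betw f L L'"
    and hom: "\<forall>x\<in>L. \<forall>y\<in>L. f (x + y) = f x + f y"
      "\<forall>c. \<forall>x\<in>L. f (s c x) = s' c (f x)"
      "\<forall>x\<in>L. \<forall>y\<in>L. f (b x y) = b' (f x) (f y)"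
    using iso unfolding alg_iso_def by blast
  let ?g = "inv_into L f"
  have g: "?g y \<in> L" "f (?g y) = y" if "y \<in> L'" for y
    using that f by (auto simp: bij_betw_def inv_into_into f_inv_into_f)
  have g_eq: "?g (f x) = x" if "x \<in> L" for x
    using that f by (simp add: bij_betw_def)
  have "?g (x + y) = ?g x + ?g y" if "x \<in> L'" "y \<in> L'" for x y
    using g_eq[of "?g x + ?g y"] that g hom add by simp
  moreover have "?g (s' c x) = s c (?g x)" if "x \<in> L'" for c x
    using g_eq[of "s c (?g x)"] that g hom scale by simp
  moreover have "?g (b' x y) = b (?g x) (?g y)" if "x \<in> L'" "y \<in> L'" for x y
    using g_eq[of "b (?g x) (?g y)"] that g hom br by simp
  moreover have "bij_betw ?g L' L"
    using f by (rule bij_betw_inv_into)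
  ultimately show ?thesis
    unfolding alg_iso_def by blast
qed

lemma alg_iso_trans:
  assumes "alg_iso s L b s' L' b'" "alg_iso s' L' b' s'' L'' b''"
  shows "alg_iso s L b s'' L'' b''"
proof -
  obtain f where f: "bij_betw f L L'"
    "\<forall>x\<in>L. \<forall>y\<in>L. f (x + y) = f x + f y"
    "\<forall>c. \<forall>x\<in>L. f (s c x) = s' c (f x)"
    "\<forall>x\<in>L. \<forall>y\<in>L. f (b x y) = b' (f x) (f y)"
    using assms(1) unfolding alg_iso_def by blast
  obtain g where g: "bij_betw g L' L''"
    "\<forall>x\<in>L'. \<forall>y\<in>L'. g (x + y) = g x + g y"
    "\<forall>c. \<forall>x\<in>L'. g (s' c x) = s'' c (g x)"
    "\<forall>x\<in>L'. \<forall>y\<in>L'. g (b' x y) = b'' (g x) (g y)"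
    using assms(2) unfolding alg_iso_def by blast
  have "f x \<in> L'" if "x \<in> L" for x
    using f(1) that by (rule bij_betw_apply)
  then show ?thesis
    unfolding alg_iso_def using f g bij_betw_trans[OF f(1) g(1)]
    by (intro exI[of _ "g \<circ> f"]) simp
qed

lemma F2j_alg_iso_sym:
  assumes "n \<ge> 3" "alg_iso coord_scale (coord_space n) (F2j_br n i) s L b"
  shows "alg_iso s L b coord_scale (coord_space n) (F2j_br n i)"
  by (rule alg_iso_sym[OF assms(2)])
    (use assms(1) in \<open>auto simp: F2j_br_def F2_br_eq_vec vec_in_space, auto simp: coord_space_def coord_scale_def\<close>)

section \<open>Pairwise non-isomorphism of the algebras \<open>F2j_br n j\<close>\<close>

lemma F2j_br_vec:
  assumes "n \<ge> 3" "3 \<le> j"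
  shows "F2j_br n j (vec n f a) (vec n g b) =
    vec n ((fps_const (g $ 0) * fps_X + fps_const b * fps_X ^ (j - 1)) * f) 0"
  using F2_br_vec[OF assms(1)] by (simp add: F2j_br_def act_single[OF assms(2)])

lemma F2j_not_alg_iso_less:
  assumes n: "n \<ge> 3" and ij: "3 \<le> i" "i < j" "j \<le> n"
  shows "\<not> alg_iso coord_scale (coord_space n) (F2j_br n i) coord_scale (coord_space n) (F2j_br n j)"
proof
  let ?V = "coord_space n"
  assume "alg_iso coord_scale ?V (F2j_br n i) coord_scale ?V (F2j_br n j)"
  then obtain \<phi> where bij: "bij_betw \<phi> ?V ?V"
    and scale: "\<forall>c. \<forall>x\<in>?V. \<phi> (coord_scale c x) = coord_scale c (\<phi> x)"
    and br: "\<forall>x\<in>?V. \<forall>y\<in>?V. \<phi> (F2j_br n i x y) = F2j_br n j (\<phi> x) (\<phi> y)"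
    unfolding alg_iso_def by blast
  have V: "vec n f a \<in> ?V" for f a
    using n by (simp add: vec_in_space)
  have \<phi>V: "\<phi> x \<in> ?V" if "x \<in> ?V" for x
    using bij that by (rule bij_betw_apply)
  have \<phi>0: "\<phi> 0 = 0"
    using scale[rule_format, of 0 0] by (simp add: coord_space_def)
  obtain u a where u: "\<phi> (vec n 1 0) = vec n u a"
    using \<phi>V[OF V] by (rule coord_space_cases)
  obtain v b where v: "\<phi> (vec n 0 1) = vec n v b"
    using \<phi>V[OF V] by (rule coord_space_cases)
  \<comment> \<open>[e_1, y] = 0 for the preimage y of e_0, hence t v = 0 modulo t^n. The image of
    e_1 then acts on the right by b t^(j-1) alone.\<close>
  have "v $ 0 = 0"
  proof -
    obtain y where y: "y \<in> ?V" "\<phi> y = vec n 1 0"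
      using bij V by (metis bij_betw_imp_surj_on imageE)
    then obtain g c where g: "y = vec n g c"
      using coord_space_cases by blast
    have "\<phi> (F2j_br n i (vec n 0 1) y) = F2j_br n j (vec n v b) (vec n 1 0)"
      using br V v y by simp
    then have "vec n (fps_X * v) 0 = vec n 0 0"
      using n ij by (simp add: g F2j_br_vec vec_0 \<phi>0)
    then have "fps_X ^ n dvd fps_X * v"
      using n by (simp add: vec_eq_iff)
    then have "(fps_X * v) $ 1 = 0"
      using n unfolding fps_X_power_dvd_iff by (auto dest!: spec[of _ 1])
    then show ?thesis by simp
  qed
  \<comment> \<open>Every right multiplication raises the order in \<open>t\<close>, so starting from \<open>[e\<^sub>0, e\<^sub>1]\<close>, which has
    order \<open>i - 1\<close> in the source but at least \<open>j - 1\<close> in the target, repeated multiplication by \<open>e\<^sub>0\<close> dies earlier in the target.\<close>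
  have order: "\<exists>g. \<phi> (vec n (fps_X ^ (i - 1 + s)) 0) = vec n (fps_X ^ (j - 1 + s) * g) 0" for s
  proof (induction s)
    case 0
    have "\<phi> (F2j_br n i (vec n 1 0) (vec n 0 1)) = F2j_br n j (vec n u a) (vec n v b)"
      using br V u v by simp
    then have "\<phi> (vec n (fps_X ^ (i - 1)) 0) = vec n (fps_X ^ (j - 1) * (fps_const b * u)) 0"
      using n ij \<open>v $ 0 = 0\<close> by (simp add: F2j_br_vec ac_simps)
    then show ?case by auto
  next
    case (Suc s)
    then obtain g where g: "\<phi> (vec n (fps_X ^ (i - 1 + s)) 0) = vec n (fps_X ^ (j - 1 + s) * g) 0" ..
    have "\<phi> (F2j_br n i (vec n (fps_X ^ (i - 1 + s)) 0) (vec n 1 0)) =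
        F2j_br n j (vec n (fps_X ^ (j - 1 + s) * g) 0) (vec n u a)"
      using br V u g by simp
    moreover have "i = Suc (i - 1)" "j = Suc (Suc (j - 2))"
      using ij by simp_all
    then obtain i' j' where ij': "i = Suc i'" "j = Suc (Suc j')"
      by metis
    ultimately have "\<phi> (vec n (fps_X ^ (i - 1 + Suc s)) 0) =
        vec n (fps_X ^ (j - 1 + Suc s) * ((fps_const (u $ 0) + fps_const a * fps_X ^ (j - 2)) * g)) 0"
      using n ij unfolding ij' by (simp add: F2j_br_vec algebra_simps)
    then show ?case by blast
  qed
  \<comment> \<open>The shift n - i brings the source exponent to n - 1, still nonzero modulo t^n,
    and the target exponent to n - 1 + (j - i), which is at least n.\<close>
  obtain g where "\<phi> (vec n (fps_X ^ (i - 1 + (n - i))) 0) = vec n (fps_X ^ (j - 1 + (n - i)) * g) 0"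
    using order by blast
  moreover have "fps_X ^ n dvd fps_X ^ (j - 1 + (n - i)) * g"
    using ij by (intro dvd_mult2 le_imp_power_dvd) auto
  then have "vec n (fps_X ^ (j - 1 + (n - i)) * g) 0 = vec n 0 0"
    using n by (simp only: vec_eq_iff) simp
  ultimately have "\<phi> (vec n (fps_X ^ (n - 1)) 0) = \<phi> (vec n 0 0)"
    using ij by (simp add: \<phi>0 vec_0)
  then have "vec n (fps_X ^ (n - 1)) 0 = vec n 0 0"
    using bij V unfolding bij_betw_def inj_on_def by blast
  then show False
    using n by (auto simp: vec_eq_iff fps_X_power_dvd_iff dest!: spec[of _ "n - 1"])
qed

lemma F2j_not_alg_iso:
  assumes "n \<ge> 3" "i \<in> {3..n}" "j \<in> {3..n}" "i \<noteq> j"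
  shows "\<not> alg_iso coord_scale (coord_space n) (F2j_br n i) coord_scale (coord_space n) (F2j_br n j)"
  using assms F2j_not_alg_iso_less[of n i j] F2j_not_alg_iso_less[of n j i] F2j_alg_iso_sym
  by (metis atLeastAtMost_iff linorder_neqE_nat)

subsection \<open>Change of parameter\<close>

text \<open>Substituting a series without constant term never lowers the order, so the substitution
  is well defined modulo t^n.\<close>

lemma fps_X_power_dvd_compose:
  fixes f T :: "'a::idom fps"
  assumes "fps_X ^ n dvd f" "T $ 0 = 0"
  shows "fps_X ^ n dvd f oo T"
proof -
  obtain g where "f = fps_X ^ n * g" using assms(1) ..
  then have "f oo T = T ^ n * (g oo T)"
    using assms(2) by (simp add: fps_compose_mult_distrib fps_X_fps_compose_startby0
        flip: fps_compose_power)
  moreover have "fps_X dvd T"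
    using assms(2) fps_X_power_dvd_iff[of 1 T] by simp
  ultimately show ?thesis
    by (simp add: dvd_power_same)
qed

lemma F2j_alg_iso_F2:
  assumes n: "n \<ge> 3" and j: "3 \<le> j" and c: "c \<noteq> 0"
    and T: "T = fps_X + fps_const \<alpha> * act \<beta>"
    and p: "fps_X ^ n dvd act \<beta> - fps_const c * T ^ (j - 1)"
  shows "alg_iso coord_scale (coord_space n) (F2j_br n j) coord_scale (coord_space n) (F2_br n \<beta> 0)"
proof -
  let ?V = "coord_space n"
  \<comment> \<open>e_0 goes to e_0 + \<alpha> e_1, whose right action is \<open>T\<close>, and e_1
    goes to e_1 / c, whose right action agrees with T^(j-1) modulo t^n by the hypothesis on
    \<open>act \<beta>\<close>.\<close>
  define \<phi> where "\<phi> x = vec n (ser x oo T) (\<alpha> * x 0 + x 1 / c)" for x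
  have T0: "T $ 0 = 0" and T1: "T $ 1 = 1"
    by (simp_all add: T)
  have T_inv0: "fps_inv T $ 0 = 0"
    by (simp add: fps_inv_def)
  have V: "vec n f a \<in> ?V" for f a
    using n by (simp add: vec_in_space)
  have \<phi>_vec: "\<phi> (vec n f a) = vec n (f oo T) (\<alpha> * f $ 0 + a / c)" for f a
    using n fps_X_power_dvd_compose[OF ser_vec T0, of n f a]
    by (simp add: \<phi>_def vec_eq_iff fps_compose_sub_distrib)
  have "inj_on \<phi> ?V"
  proof (rule inj_onI)
    fix x y assume xy: "x \<in> ?V" "y \<in> ?V" "\<phi> x = \<phi> y"
    obtain f a where x: "x = vec n f a" using xy(1) by (rule coord_space_cases)
    obtain g b where y: "y = vec n g b" using xy(2) by (rule coord_space_cases)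
    have *: "fps_X ^ n dvd (f - g) oo T" "\<alpha> * f $ 0 + a / c = \<alpha> * g $ 0 + b / c"
      using xy(3) n by (simp_all add: x y \<phi>_vec vec_eq_iff fps_compose_sub_distrib)
    have "fps_X ^ n dvd (f - g) oo T oo fps_inv T"
      using *(1) T_inv0 by (rule fps_X_power_dvd_compose)
    then have fg: "fps_X ^ n dvd f - g"
      using T0 T1 T_inv0 by (simp add: fps_inv_right flip: fps_compose_assoc)
    \<comment> \<open>The e_1 coordinate of the image contains \<alpha> f(0), so \<open>a\<close>
      and \<open>b\<close> can be compared only once the constant terms agree.\<close>
    then have "(f - g) $ 0 = 0"
      using n unfolding fps_X_power_dvd_iff by simp
    then show "x = y"
      using fg *(2) c n by (simp add: x y vec_eq_iff)
  qed
  moreover have "\<phi> ` ?V = ?V"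
  proof (intro subset_antisym subsetI)
    fix y assume "y \<in> ?V"
    then obtain g b where y: "y = vec n g b" by (rule coord_space_cases)
    define f where "f = g oo fps_inv T"
    have "f oo T = g oo (fps_inv T oo T)"
      unfolding f_def using T0 T_inv0 by (simp add: fps_compose_assoc)
    then have "y = \<phi> (vec n f (c * (b - \<alpha> * f $ 0)))"
      using T0 T1 c by (simp add: y \<phi>_vec fps_inv)
    then show "y \<in> \<phi> ` ?V"
      using V by blast
  qed (auto simp: \<phi>_def V)
  ultimately have "bij_betw \<phi> ?V ?V"
    by (simp add: bij_betw_def)
  moreover have "\<phi> (x + y) = \<phi> x + \<phi> y" for x y
    by (simp add: \<phi>_def vec_add ser_add fps_compose_add_distrib algebra_simps add_divide_distrib)
  moreover have "\<phi> (coord_scale k x) = coord_scale k (\<phi> x)" for k x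
    using T0 by (simp add: \<phi>_def vec_scale ser_scale fps_compose_mult_distrib)
      (simp add: coord_scale_def algebra_simps)
  moreover have "\<phi> (F2j_br n j x y) = F2_br n \<beta> 0 (\<phi> x) (\<phi> y)" if xy: "x \<in> ?V" "y \<in> ?V" for x y
  proof -
    obtain f a where x: "x = vec n f a" using xy(1) by (rule coord_space_cases)
    obtain g b where y: "y = vec n g b" using xy(2) by (rule coord_space_cases)
    have "\<phi> (F2j_br n j x y) =
        vec n ((fps_const (g $ 0) * T + fps_const b * T ^ (j - 1)) * (f oo T)) 0"
      using n j T0 unfolding x y F2j_br_def F2_br_vec[OF n] act_single[OF j] \<phi>_vec
      by (simp add: fps_compose_mult_distrib fps_compose_add_distrib fps_X_fps_compose_startby0
          flip: fps_compose_power)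
    also have "\<dots> = vec n ((fps_const (g $ 0) * fps_X + fps_const (\<alpha> * g $ 0 + b / c) * act \<beta>) * (f oo T)) 0"
    proof (rule vec_cong)
      \<comment> \<open>The terms with g(0) cancel by the definition of \<open>T\<close>. Splitting
        b as (b / c) c makes the rest a multiple of c T^(j-1) - p, which vanishes modulo
        t^n.\<close>
      have "(fps_const (g $ 0) * T + fps_const b * T ^ (j - 1)) * (f oo T) -
          (fps_const (g $ 0) * fps_X + fps_const (\<alpha> * g $ 0 + b / c) * act \<beta>) * (f oo T) =
          (fps_const c * T ^ (j - 1) - act \<beta>) * (fps_const (b / c) * (f oo T))"
      proof -
        have b: "fps_const b = fps_const (b / c) * fps_const c"
          using c by simp
        have "fps_const (\<alpha> * g $ 0 + b / c) = fps_const \<alpha> * fps_const (g $ 0) + fps_const (b / c)"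
          by simp
        moreover have "(G * (fps_X + A * P) + K * C * Q) * F - (G * fps_X + (A * G + K) * P) * F =
            (C * Q - P) * (K * F)" for G A P K C Q F :: "complex fps"
          by (simp add: algebra_simps)
        ultimately show ?thesis
          unfolding b T by (simp only:)
      qed
      moreover have "fps_X ^ n dvd fps_const c * T ^ (j - 1) - act \<beta>"
        using p by (simp add: dvd_diff_commute)
      ultimately show "fps_X ^ n dvd (fps_const (g $ 0) * T + fps_const b * T ^ (j - 1)) * (f oo T) -
          (fps_const (g $ 0) * fps_X + fps_const (\<alpha> * g $ 0 + b / c) * act \<beta>) * (f oo T)"
        by simp
    qed (use n in auto)
    also have "\<dots> = F2_br n \<beta> 0 (\<phi> x) (\<phi> y)"
      by (simp add: x y \<phi>_vec F2_br_vec[OF n])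
    finally show ?thesis .
  qed
  ultimately show ?thesis
    unfolding alg_iso_def by blast
qed

text \<open>The extra factor \<open>f\<close> restores the exponent lowered by differentiation, so
  no m - 1 appears and m = 0 is covered.\<close>

lemma fps_deriv_power_mult_self:
  fixes f :: "'a::comm_semiring_1 fps"
  shows "fps_deriv (f ^ m) * f = of_nat m * f ^ m * fps_deriv f"
proof (cases m)
  case (Suc l)
  then have "fps_deriv (f ^ m) = of_nat m * fps_deriv f * f ^ l"
    by (simp add: fps_deriv_power' del: power_Suc)
  then show ?thesis
    by (simp add: Suc algebra_simps)
qed simp

text \<open>The hypothesis says that \<open>p\<close> and \<open>T\<^sup>m\<close> have the same logarithmic derivative modulo \<open>t\<^sup>n\<close>.\<close>

lemma dvd_sub_power_if_log_deriv:
  fixes p T :: "complex fps"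
  assumes T0: "T $ 0 = 0" and T1: "T $ 1 = 1"
    and low: "fps_X ^ m dvd p"
    and ode: "fps_X ^ n dvd fps_deriv p * T - of_nat m * p * fps_deriv T"
  shows "fps_X ^ n dvd p - fps_const (p $ m) * T ^ m"
proof -
  define r where "r = p - fps_const (p $ m) * T ^ m"
  have "fps_deriv (T ^ m) * T = of_nat m * T ^ m * fps_deriv T"
    by (rule fps_deriv_power_mult_self)
  \<comment> \<open>T^m solves the equation exactly and the equation is linear in p, so the
    difference \<open>r\<close> satisfies the same congruence.\<close>
  then have "fps_deriv r * T - of_nat m * r * fps_deriv T = fps_deriv p * T - of_nat m * p * fps_deriv T"
    unfolding r_def by (simp add: algebra_simps)
  with ode have r: "fps_X ^ n dvd fps_deriv r * T - of_nat m * r * fps_deriv T"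
    by simp
  have "r $ k = 0" if "k < n" for k
    using that
  proof (induction k rule: less_induct)
    case (less k)
    show ?case
    proof (cases "k \<le> m")
      \<comment> \<open>Both p and T^m have order at least m, and T^m has coefficient 1 in degree m
        because T'(0) = 1.\<close>
      case True
      then show ?thesis
        using low startsby_zero_power_prefix[OF T0, of m] startsby_zero_power_nth_same[OF T0, of m] T1
        by (cases "k = m") (auto simp: r_def fps_X_power_dvd_iff)
    next
      case False
      \<comment> \<open>Once the lower coefficients of \<open>r\<close> vanish, the coefficient of
        degree k of the equation is (k - m) r_k, and k > m.\<close>
      have "fps_X ^ k dvd r"
        using less by (simp add: fps_X_power_dvd_iff)
      then obtain h where h: "r = fps_X ^ k * h" ..
      have "fps_X dvd T" using T0 fps_X_power_dvd_iff[of 1 T] by simp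
      then obtain S where S: "T = fps_X * S" ..
      have "fps_deriv r * T = fps_deriv (fps_X ^ k) * fps_X * (h * S) + fps_X ^ k * (fps_X * fps_deriv h * S)"
        unfolding h S by (simp only: fps_deriv_mult algebra_simps)
      then have "fps_deriv r * T - of_nat m * r * fps_deriv T =
          fps_X ^ k * ((of_nat k * h + fps_X * fps_deriv h) * S - of_nat m * h * fps_deriv T)"
        unfolding fps_deriv_power_mult_self h by (simp add: algebra_simps)
      moreover have "(fps_deriv r * T - of_nat m * r * fps_deriv T) $ k = 0"
        using r less.prems by (simp add: fps_X_power_dvd_iff)
      ultimately have "((of_nat k * h + fps_X * fps_deriv h) * S - of_nat m * h * fps_deriv T) $ 0 = 0"
        by (simp only: fps_X_power_mult_nth) simp
      moreover have "S $ 0 = 1"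
        using T1 by (simp add: S)
      ultimately have "(of_nat k - of_nat m) * h $ 0 = (0::complex)"
        using T1 by (simp add: algebra_simps flip: fps_of_nat)
      then show ?thesis
        using False by (simp add: h fps_X_power_mult_nth)
    qed
  qed
  then show ?thesis
    by (simp add: fps_X_power_dvd_iff r_def)
qed

subsection \<open>Derivations\<close>

text \<open>
  Writing \<open>d e\<^sub>0 = u + a e\<^sub>1\<close> and \<open>d e\<^sub>1 = v + b e\<^sub>1\<close>, the last congruence is the derivation rule at
  \<open>[e\<^sub>0, e\<^sub>1] = p\<close>; the lower bound on \<open>v\<close> comes from \<open>[e\<^sub>1, e\<^sub>0] = 0\<close>.
\<close>

lemma F2_derivation_form:
  assumes n: "n \<ge> 3"
    and closed: "\<And>x. x \<in> coord_space n \<Longrightarrow> D x \<in> coord_space n"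
    and add: "\<And>x y. x \<in> coord_space n \<Longrightarrow> y \<in> coord_space n \<Longrightarrow> D (x + y) = D x + D y"
    and scale: "\<And>c x. x \<in> coord_space n \<Longrightarrow> D (coord_scale c x) = coord_scale c (D x)"
    and br: "\<And>x y. x \<in> coord_space n \<Longrightarrow> y \<in> coord_space n \<Longrightarrow>
      D (F2_br n \<beta> 0 x y) = F2_br n \<beta> 0 (D x) y + F2_br n \<beta> 0 x (D y)"
  obtains u v a b where
    "\<forall>f c. D (vec n f c) =
      vec n (u * f + fps_deriv f * (fps_const (u $ 0) * fps_X + fps_const a * act \<beta>) + fps_const c * v)
        (a * f $ 0 + b * c)"
    "fps_X ^ (n - 1) dvd v"
    "fps_X ^ n dvd fps_deriv (act \<beta>) * (fps_const (u $ 0) * fps_X + fps_const a * act \<beta>) - fps_const b * act \<beta>"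
proof -
  have V: "vec n f c \<in> coord_space n" for f c
    using n by (simp add: vec_in_space)
  note br_vec = F2_br_vec[OF n]
  obtain u a where u: "D (vec n 1 0) = vec n u a"
    using closed[OF V] by (rule coord_space_cases)
  obtain v b where v: "D (vec n 0 1) = vec n v b"
    using closed[OF V] by (rule coord_space_cases)
  \<comment> \<open>The series by which D e_0 acts from the right.\<close>
  define w where "w = fps_const (u $ 0) * fps_X + fps_const a * act \<beta>"
  have D0: "D 0 = 0"
    using scale[OF V, of 0 0 0] by simp
  have "D (F2_br n \<beta> 0 (vec n 0 1) (vec n 1 0)) = vec n (fps_X * v) 0"
    unfolding br[OF V V] u v by (simp add: br_vec vec_add)
  then have "vec n (fps_X * v) 0 = vec n 0 0"
    by (simp add: br_vec vec_0 D0)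
  then have "fps_X ^ n dvd fps_X * v"
    using n by (simp add: vec_eq_iff)
  then have v_low: "fps_X ^ (n - 1) dvd v"
  proof -
    have "fps_X ^ n = fps_X * (fps_X ^ (n - 1) :: complex fps)"
      using n by (simp flip: power_Suc)
    then show ?thesis
      using \<open>fps_X ^ n dvd fps_X * v\<close> by simp
  qed
  \<comment> \<open>Since t^(k+1) = [t^k, e_0], the derivation rule propagates D from e_0 to all
    powers of t; on them the series part of D is u + w d/dt.\<close>
  have D_power: "D (vec n (fps_X ^ k) 0) = vec n (u * fps_X ^ k + fps_deriv (fps_X ^ k) * w) (a * fps_X ^ k $ 0)" for k
  proof (induction k)
    case 0
    then show ?case by (simp add: u)
  next
    case (Suc k)
    have "D (vec n (fps_X ^ Suc k) 0) = D (F2_br n \<beta> 0 (vec n (fps_X ^ k) 0) (vec n 1 0))"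
      by (simp add: br_vec)
    also have "\<dots> = vec n (fps_X * (u * fps_X ^ k + fps_deriv (fps_X ^ k) * w) + w * fps_X ^ k) 0"
      unfolding br[OF V V] Suc.IH u by (simp add: br_vec vec_add w_def)
    also have "fps_X * (u * fps_X ^ k + fps_deriv (fps_X ^ k) * w) + w * fps_X ^ k =
        u * fps_X ^ Suc k + fps_deriv (fps_X ^ Suc k) * w"
      by (simp add: algebra_simps)
    finally show ?case by simp
  qed
  have D_fps: "D (vec n f 0) = vec n (u * f + fps_deriv f * w) (a * f $ 0)" for f
  proof -
    \<comment> \<open>Linearity reaches only finite sums, so f is replaced by its truncation
      \<open>g n\<close>, the same vector modulo t^n.\<close>
    define g where "g k = (\<Sum>i<k. fps_const (f $ i) * fps_X ^ i)" for k
    have g: "D (vec n (g k) 0) = vec n (u * g k + fps_deriv (g k) * w) (a * g k $ 0)" for k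
    proof (induction k)
      case 0
      have "g 0 = 0" by (simp add: g_def)
      have "D (vec n (g 0) 0) = vec n 0 0"
        unfolding \<open>g 0 = 0\<close> vec_0 D0 ..
      then show ?case by (simp add: \<open>g 0 = 0\<close>)
    next
      case (Suc k)
      have "D (vec n (g (Suc k)) 0) = D (vec n (g k) 0 + coord_scale (f $ k) (vec n (fps_X ^ k) 0))"
        by (simp add: g_def vec_add vec_scale)
      also have "\<dots> = D (vec n (g k) 0) + coord_scale (f $ k) (D (vec n (fps_X ^ k) 0))"
        using V by (simp add: add scale vec_scale)
          (simp add: scale flip: vec_scale[of "f $ k" n "fps_X ^ k" 0, simplified])
      also have "\<dots> = vec n (u * g (Suc k) + fps_deriv (g (Suc k)) * w) (a * g (Suc k) $ 0)"
        unfolding Suc.IH D_power vec_scale vec_add by (simp add: g_def algebra_simps)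
      finally show ?case .
    qed
    have "g n $ k = f $ k" if "k < n" for k
      using that by (simp add: g_def fps_sum_nth if_distrib cong: if_cong)
    then have gf: "fps_X ^ n dvd g n - f"
      by (simp add: fps_X_power_dvd_iff)
    \<comment> \<open>Differentiating \<open>g n - f\<close> loses one power of t; the factor
      \<open>w\<close> has no constant term and restores it.\<close>
    have "fps_X dvd w"
      using fps_X_power_dvd_iff[of 1 w] by (simp add: w_def)
    moreover have "fps_X ^ (n - 1) dvd fps_deriv (g n - f)"
      using gf by (auto simp: fps_X_power_dvd_iff)
    ultimately have "fps_X ^ (n - 1) * fps_X dvd fps_deriv (g n - f) * w"
      by (intro mult_dvd_mono)
    then have "fps_X ^ n dvd fps_deriv (g n - f) * w"
      using n by (simp flip: power_Suc2)
    then have "fps_X ^ n dvd u * (g n - f) + fps_deriv (g n - f) * w"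
      using gf by simp
    moreover have "u * (g n - f) + fps_deriv (g n - f) * w =
        (u * g n + fps_deriv (g n) * w) - (u * f + fps_deriv f * w)"
      by (simp add: algebra_simps)
    ultimately have "vec n (u * g n + fps_deriv (g n) * w) (a * g n $ 0) = vec n (u * f + fps_deriv f * w) (a * f $ 0)"
      using n \<open>\<And>k. k < n \<Longrightarrow> g n $ k = f $ k\<close>[of 0] by (intro vec_cong) auto
    moreover have "vec n (g n) 0 = vec n f 0"
      using n gf by (simp add: vec_eq_iff)
    ultimately show ?thesis
      using g[of n] by simp
  qed
  have D_vec: "D (vec n f c) = vec n (u * f + fps_deriv f * w + fps_const c * v) (a * f $ 0 + b * c)" for f c
  proof -
    have "D (vec n f c) = D (vec n f 0 + coord_scale c (vec n 0 1))"
      by (simp add: vec_add vec_scale)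
    also have "\<dots> = D (vec n f 0) + coord_scale c (D (vec n 0 1))"
      using V add[of "vec n f 0" "vec n 0 c"] scale[of "vec n 0 1" c] by (simp add: vec_scale)
    finally show ?thesis
      by (simp add: D_fps v vec_add vec_scale mult.commute)
  qed
  have v0: "v $ 0 = 0"
    using v_low n by (simp add: fps_X_power_dvd_iff)
  have "D (F2_br n \<beta> 0 (vec n 1 0) (vec n 0 1)) = vec n (act \<beta> * u + fps_const b * act \<beta>) 0"
    unfolding br[OF V V] u v by (simp add: v0 br_vec vec_add)
  then have "fps_X ^ n dvd (u * act \<beta> + fps_deriv (act \<beta>) * w) - (act \<beta> * u + fps_const b * act \<beta>)"
    using n by (simp add: br_vec D_vec vec_eq_iff)
  then have "fps_X ^ n dvd fps_deriv (act \<beta>) * w - fps_const b * act \<beta>"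
    by (simp add: algebra_simps)
  then show ?thesis
    using that[OF _ v_low] D_vec unfolding w_def by blast
qed

text \<open>One application removes the constant term and a second removes the e_1 coordinate. From
  then on each application raises the order: u has no constant term, and p, of order at least 2,
  outweighs the degree lost by differentiation. Order n is reached after n + 1 applications.\<close>

lemma F2_derivation_nilpotent:
  assumes n: "n \<ge> 3"
    and D: "\<And>f c. D (vec n f c) =
      vec n (u * f + fps_deriv f * (fps_const a * act \<beta>) + fps_const c * v) (a * f $ 0)"
    and v: "fps_X ^ (n - 1) dvd v" and u: "u $ 0 = 0"
    and x: "x \<in> coord_space n"
  shows "(D ^^ (n + 1)) x = 0"
proof -
  have X_sq: "fps_X ^ 2 dvd act \<beta>"
    by (simp add: fps_X_power_dvd_iff act_def)
  have Xu: "fps_X dvd u"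
    using u fps_X_power_dvd_iff[of 1 u] by simp
  have Xv: "fps_X dvd v"
    using v n by (meson dvd_power dvd_trans zero_less_diff less_le_trans one_less_numeral_iff semiring_norm(77))
  have raise: "\<exists>g. D (vec n (fps_X ^ Suc k * f) 0) = vec n (fps_X ^ Suc (Suc k) * g) 0" for k f
  proof -
    have "(fps_X ^ Suc k * f) $ i = 0" if "i \<le> k" for i
      unfolding fps_X_power_mult_nth using that by simp
    then have "fps_X ^ k dvd fps_deriv (fps_X ^ Suc k * f)"
      unfolding fps_X_power_dvd_iff fps_deriv_nth by simp
    then have "fps_X ^ k * fps_X ^ 2 dvd fps_deriv (fps_X ^ Suc k * f) * (fps_const a * act \<beta>)"
      using X_sq by (intro mult_dvd_mono) auto
    then have "fps_X ^ Suc (Suc k) dvd fps_deriv (fps_X ^ Suc k * f) * (fps_const a * act \<beta>)"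
      by (simp add: power2_eq_square mult_ac)
    moreover have "fps_X ^ Suc (Suc k) dvd u * (fps_X ^ Suc k * f)"
      using Xu by (simp add: mult_dvd_mono)
    ultimately have "fps_X ^ Suc (Suc k) dvd
        u * (fps_X ^ Suc k * f) + fps_deriv (fps_X ^ Suc k * f) * (fps_const a * act \<beta>)"
      by (rule dvd_add[rotated])
    then show ?thesis
      unfolding D dvd_def by (auto simp del: power_Suc fps_deriv_mult)
  qed
  have start: "\<exists>g. (D ^^ 2) x = vec n (fps_X * g) 0"
  proof -
    obtain f c where f: "x = vec n f c" using x by (rule coord_space_cases)
    have Xact: "fps_X dvd act \<beta>"
      using X_sq by (auto simp: power2_eq_square dvd_mult_left)
    let ?f1 = "u * f + fps_deriv f * (fps_const a * act \<beta>) + fps_const c * v"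
    have Xf1: "fps_X dvd ?f1"
      using Xu Xv Xact by (intro dvd_add) auto
    then have "?f1 $ 0 = 0"
      using fps_X_power_dvd_iff[of 1 ?f1] by simp
    then have "(D ^^ 2) x =
        vec n (u * ?f1 + fps_deriv ?f1 * (fps_const a * act \<beta>) + fps_const (a * f $ 0) * v) 0"
      unfolding f numeral_2_eq_2 by (simp only: funpow.simps o_apply id_apply D) simp
    moreover have "fps_X dvd u * ?f1 + fps_deriv ?f1 * (fps_const a * act \<beta>) + fps_const (a * f $ 0) * v"
      using Xu Xv Xact by (intro dvd_add) auto
    ultimately show ?thesis
      unfolding dvd_def by metis
  qed
  have "\<exists>g. (D ^^ (k + 2)) x = vec n (fps_X ^ Suc k * g) 0" for k
  proof (induction k)
    case 0
    then show ?case
      using start by (simp only: add_0_left power_Suc power_0 mult_1_right)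
  next
    case (Suc k)
    then show ?case using raise by (metis add_Suc funpow.simps(2) o_apply)
  qed
  from this[of "n - 1"] obtain g where "(D ^^ (n + 1)) x = vec n (fps_X ^ n * g) 0"
    using n by (auto simp del: funpow.simps)
  also have "\<dots> = vec n 0 0"
    using n by (intro vec_cong) auto
  finally show ?thesis by (simp add: vec_0)
qed

subsection \<open>Classification\<close>

lemma F2_alg_iso_F2j:
  assumes n: "n \<ge> 3"
    and closed: "\<And>x. x \<in> coord_space n \<Longrightarrow> D x \<in> coord_space n"
    and add: "\<And>x y. x \<in> coord_space n \<Longrightarrow> y \<in> coord_space n \<Longrightarrow> D (x + y) = D x + D y"
    and scale: "\<And>c x. x \<in> coord_space n \<Longrightarrow> D (coord_scale c x) = coord_scale c (D x)"
    and br: "\<And>x y. x \<in> coord_space n \<Longrightarrow> y \<in> coord_space n \<Longrightarrow>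
      D (F2_br n \<beta> 0 x y) = F2_br n \<beta> 0 (D x) y + F2_br n \<beta> 0 x (D y)"
    and not_nilp: "\<exists>x\<in>coord_space n. (D ^^ (n + 1)) x \<noteq> 0"
    and \<beta>: "\<exists>k\<in>{3..n}. \<beta> k \<noteq> 0"
  shows "\<exists>j\<in>{3..n}. alg_iso coord_scale (coord_space n) (F2_br n \<beta> 0) coord_scale (coord_space n) (F2j_br n j)"
proof -
  define p where "p = act \<beta>"
  obtain u v a b where D: "\<forall>f c. D (vec n f c) =
      vec n (u * f + fps_deriv f * (fps_const (u $ 0) * fps_X + fps_const a * act \<beta>) + fps_const c * v)
        (a * f $ 0 + b * c)"
    and v: "fps_X ^ (n - 1) dvd v"
    and ode: "fps_X ^ n dvd fps_deriv p * (fps_const (u $ 0) * fps_X + fps_const a * p) - fps_const b * p"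
    unfolding p_def by (rule F2_derivation_form[OF n closed add scale br])
  define m where "m = subdegree p"
  obtain k where k: "k \<in> {3..n}" "\<beta> k \<noteq> 0" using \<beta> by blast
  then have "\<not> k - 1 < 2" "Suc (k - 1) = k"
    by auto
  then have pk: "p $ (k - 1) \<noteq> 0"
    using k(2) unfolding p_def act_def by simp
  have p: "p \<noteq> 0"
    using pk by (metis fps_zero_nth)
  have "m \<le> k - 1"
    unfolding m_def using pk by (rule subdegree_leI)
  then have mn: "m < n"
    using k(1) by auto
  have pm: "p $ m \<noteq> 0"
    unfolding m_def using p by (rule nth_subdegree_nonzero)
  have low: "fps_X ^ m dvd p"
    unfolding fps_X_power_dvd_iff m_def using nth_less_subdegree_zero by blast
  have m2: "m \<ge> 2"
  proof (rule ccontr)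
    assume "\<not> m \<ge> 2"
    then have "p $ m = 0"
      by (simp add: p_def act_def)
    with pm show False ..
  qed
  \<comment> \<open>Coefficient of degree m of \<open>ode\<close>: the term u(0) t p' gives m u(0)
    p_m, while a p p' has order at least 2m - 1 > m because m >= 2.\<close>
  have b: "b = of_nat m * u $ 0"
  proof -
    obtain h where h: "p = fps_X ^ m * h" using low ..
    define G where "G = (of_nat m * h + fps_X * fps_deriv h) *
        (fps_const (u $ 0) + fps_const a * fps_X ^ (m - 1) * h) - fps_const b * h"
    have Xm: "fps_X ^ m = fps_X * (fps_X ^ (m - 1) :: complex fps)"
      using m2 by (cases m) simp_all
    have Xm': "fps_deriv (fps_X ^ m) * fps_X = of_nat m * (fps_X :: complex fps) ^ m"
      using fps_deriv_power_mult_self[of "fps_X :: complex fps" m] by (simp only: fps_deriv_fps_X mult_1_right)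
    have factor: "(Y * h' + E * h) * (U * fps_X + A * (Y * h)) - B * (Y * h) =
        Y * ((M * h + fps_X * h') * (U + A * Z * h) - B * h)"
      if "Y = fps_X * Z" "E * fps_X = M * Y" for E h' Y U A B M Z :: "complex fps"
    proof -
      have "(Y * h' + E * h) * (U * fps_X + A * (Y * h)) - B * (Y * h) =
          (E * fps_X * h + Y * h' * fps_X) * (U + A * Z * h) - B * (Y * h)"
        unfolding that(1) by (simp add: algebra_simps)
      then show ?thesis
        unfolding that(2) by (simp add: algebra_simps)
    qed
    have "fps_deriv p * (fps_const (u $ 0) * fps_X + fps_const a * p) - fps_const b * p = fps_X ^ m * G"
      unfolding h fps_deriv_mult G_def by (rule factor[OF Xm Xm'])
    then have "(fps_X ^ m * G) $ m = 0"
      using ode mn by (simp add: fps_X_power_dvd_iff)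
    then have "G $ 0 = 0"
      by (simp add: fps_X_power_mult_nth)
    moreover have "(fps_X ^ (m - 1) :: complex fps) $ 0 = 0"
      using m2 by simp
    ultimately have "h $ 0 * (of_nat m * u $ 0 - b) = 0"
      by (simp add: G_def algebra_simps flip: fps_of_nat)
    moreover have "h $ 0 \<noteq> 0"
      using pm by (simp add: h fps_X_power_mult_nth)
    ultimately show ?thesis by simp
  qed
  have u0: "u $ 0 \<noteq> 0"
  proof
    \<comment> \<open>Then b = m u(0) vanishes too, which leaves exactly the nilpotent
      shape.\<close>
    assume u0: "u $ 0 = 0"
    have "D (vec n f c) =
        vec n (u * f + fps_deriv f * (fps_const a * act \<beta>) + fps_const c * v) (a * f $ 0)" for f c
      using D[rule_format, of f c] by (simp add: b u0)
    then show False
      using F2_derivation_nilpotent[OF n _ v u0] not_nilp by blast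
  qed
  \<comment> \<open>This \<open>\<alpha>\<close> turns \<open>p' (u\<^sub>0 t + a p) = m u\<^sub>0 p\<close> into \<open>p' T = m p T'\<close> for \<open>T = t + \<alpha> p\<close>.\<close>
  define \<alpha> where "\<alpha> = a / (u $ 0 * (1 - of_nat m))"
  have a: "a = u $ 0 * (1 - of_nat m) * \<alpha>"
    using u0 m2 by (simp add: \<alpha>_def)
  define T where "T = fps_X + fps_const \<alpha> * p"
  have "fps_X ^ n dvd fps_deriv p * T - of_nat m * p * fps_deriv T"
  proof -
    have "fps_const a = fps_const (u $ 0) * (1 - of_nat m) * fps_const \<alpha>"
      unfolding a by (simp only: fps_const_mult[symmetric] fps_const_sub[symmetric] fps_const_1_eq_1 fps_of_nat)
    moreover have "fps_const b = of_nat m * fps_const (u $ 0)"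
      unfolding b by (simp only: fps_const_mult[symmetric] fps_of_nat)
    moreover have "fps_deriv T = 1 + fps_const \<alpha> * fps_deriv p"
      by (simp add: T_def)
    moreover have "P' * (U * fps_X + U * (1 - M) * A * P) - M * U * P =
        U * (P' * (fps_X + A * P) - M * P * (1 + A * P'))" for P P' U M A :: "complex fps"
      by (simp add: algebra_simps)
    ultimately have "fps_deriv p * (fps_const (u $ 0) * fps_X + fps_const a * p) - fps_const b * p =
        fps_const (u $ 0) * (fps_deriv p * T - of_nat m * p * fps_deriv T)"
      unfolding T_def by (simp only:)
    with ode have "fps_X ^ n dvd fps_const (u $ 0) * (fps_deriv p * T - of_nat m * p * fps_deriv T)"
      by simp
    moreover have "fps_const (u $ 0) dvd 1"
      using u0 by simp
    ultimately show ?thesis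
      by (simp add: dvd_mult_unit_iff')
  qed
  then have "fps_X ^ n dvd p - fps_const (p $ m) * T ^ m"
    using low by (intro dvd_sub_power_if_log_deriv) (auto simp: T_def p_def)
  \<comment> \<open>The power t^m is the basis vector e_(m+1), hence j = m + 1; the bounds 2 <= m <
    n place it in 3..n.\<close>
  then have "alg_iso coord_scale (coord_space n) (F2j_br n (Suc m)) coord_scale (coord_space n) (F2_br n \<beta> 0)"
    using n m2 pm by (intro F2j_alg_iso_F2[of _ _ "p $ m" T \<alpha>]) (auto simp: T_def p_def)
  then have "alg_iso coord_scale (coord_space n) (F2_br n \<beta> 0) coord_scale (coord_space n) (F2j_br n (Suc m))"
    by (rule F2j_alg_iso_sym[OF n])
  then show ?thesis
    using m2 mn by (intro bexI[of _ "Suc m"]) auto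
qed

section \<open>Transport of a derivation of \<open>L\<close> to coordinates\<close>

theorem theorem3p12:
  fixes scale :: "complex \<Rightarrow> 'a::ab_group_add \<Rightarrow> 'a"
    and L :: "'a set"
    and br :: "'a \<Rightarrow> 'a \<Rightarrow> 'a"
    and n :: nat
    and \<beta> :: "nat \<Rightarrow> complex"
    and \<gamma> :: complex
  assumes "n \<ge> 3"
    and "leibniz_algebra scale L br"
    and "complex_algebra.filiform scale L br"
    and "complex_algebra.non_char_nilpotent scale L br"
    and "alg_iso scale L br coord_scale (coord_space n) (F2_br n \<beta> \<gamma>)"
    and "\<gamma> = 0"
    and "\<exists>k\<in>{3..n}. \<beta> k \<noteq> 0"
  shows "(\<exists>j\<in>{3..n}. alg_iso scale L br coord_scale (coord_space n) (F2j_br n j)) \<and>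
         (\<forall>i\<in>{3..n}. \<forall>j\<in>{3..n}. i \<noteq> j \<longrightarrow>
            \<not> alg_iso coord_scale (coord_space n) (F2j_br n i)
                      coord_scale (coord_space n) (F2j_br n j))"
proof (intro conjI ballI impI)
  interpret leibniz_algebra scale L br by fact
  let ?V = "coord_space n"
  obtain d where d: "derivation d" "\<not> nilpotent_map d"
    using assms(4) unfolding non_char_nilpotent_def by blast
  then have dL: "d x \<in> L" if "x \<in> L" for x
    using that by (simp add: derivation_def)
  obtain f where bij: "bij_betw f L ?V"
    and f_add: "\<forall>x\<in>L. \<forall>y\<in>L. f (x + y) = f x + f y"
    and f_scale: "\<forall>c. \<forall>x\<in>L. f (scale c x) = coord_scale c (f x)"
    and f_br: "\<forall>x\<in>L. \<forall>y\<in>L. f (br x y) = F2_br n \<beta> 0 (f x) (f y)"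
    using assms(5) unfolding \<open>\<gamma> = 0\<close> alg_iso_def by blast
  have fV: "f x \<in> ?V" if "x \<in> L" for x
    using bij that by (rule bij_betw_apply)
  have lift: "\<exists>z\<in>L. x = f z" if "x \<in> ?V" for x
    using bij that by (auto simp: bij_betw_def)
  \<comment> \<open>The derivation is conjugated by the isomorphism; its powers correspond on
    \<open>L\<close>, so failure of nilpotency carries over.\<close>
  define D where "D = f \<circ> d \<circ> inv_into L f"
  have D: "D (f x) = f (d x)" if "x \<in> L" for x
    using bij that by (simp add: D_def bij_betw_def)
  have D_pow: "(d ^^ k) x \<in> L \<and> (D ^^ k) (f x) = f ((d ^^ k) x)" if "x \<in> L" for k x
    using that by (induction k) (auto simp: dL D)
  have L_add: "x + y \<in> L" if "x \<in> L" "y \<in> L" for x y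
    using subspace_L that by (rule subspace_add)
  have L_scale: "scale c x \<in> L" if "x \<in> L" for c x
    using subspace_L that by (rule subspace_scale)
  have f0: "x = 0" if "x \<in> L" "f x = 0" for x
  proof -
    have "f (scale 0 x) = coord_scale 0 (f x)"
      using f_scale that(1) by blast
    then have "f 0 = f x"
      using that(2) by simp
    then show ?thesis
      using bij that(1) L_scale[of x 0] unfolding bij_betw_def inj_on_def by force
  qed
  have "\<exists>j\<in>{3..n}. alg_iso coord_scale ?V (F2_br n \<beta> 0) coord_scale ?V (F2j_br n j)"
  proof (rule F2_alg_iso_F2j[of n D])
    show "D x \<in> ?V" if "x \<in> ?V" for x
      using lift[OF that] D dL fV by auto
    show "D (x + y) = D x + D y" if xy: "x \<in> ?V" "y \<in> ?V" for x y
    proof -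
      obtain z w where zw: "z \<in> L" "w \<in> L" and [simp]: "x = f z" "y = f w"
        using lift xy by blast
      have "D (x + y) = D (f (z + w))"
        using zw f_add by simp
      also have "\<dots> = f (d z + d w)"
        using zw d(1) by (simp add: D L_add derivation_def)
      also have "\<dots> = D x + D y"
        using zw dL f_add by (simp add: D)
      finally show ?thesis .
    qed
    show "D (coord_scale c x) = coord_scale c (D x)" if x: "x \<in> ?V" for c x
    proof -
      obtain z where z: "z \<in> L" and [simp]: "x = f z"
        using lift x by blast
      have "D (coord_scale c x) = D (f (scale c z))"
        using z f_scale by simp
      also have "\<dots> = f (scale c (d z))"
        using z d(1) by (simp add: D L_scale derivation_def)
      also have "\<dots> = coord_scale c (D x)"
        using z dL f_scale by (simp add: D)
      finally show ?thesis .
    qed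
    show "D (F2_br n \<beta> 0 x y) = F2_br n \<beta> 0 (D x) y + F2_br n \<beta> 0 x (D y)"
      if xy: "x \<in> ?V" "y \<in> ?V" for x y
    proof -
      obtain z w where zw: "z \<in> L" "w \<in> L" and [simp]: "x = f z" "y = f w"
        using lift xy by blast
      have "D (F2_br n \<beta> 0 x y) = D (f (br z w))"
        using zw f_br by simp
      also have "\<dots> = f (br (d z) w + br z (d w))"
        using zw d(1) by (simp add: D br_closed derivation_def)
      also have "\<dots> = F2_br n \<beta> 0 (D x) y + F2_br n \<beta> 0 x (D y)"
        using zw dL f_add f_br by (simp add: D br_closed)
      finally show ?thesis .
    qed
    show "\<exists>x\<in>?V. (D ^^ (n + 1)) x \<noteq> 0"
    proof -
      \<comment> \<open>A map that is not nilpotent has a vector surviving every prescribed power; n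
        + 1 is the exponent used in the nilpotency bound.\<close>
      obtain z where z: "z \<in> L" "(d ^^ (n + 1)) z \<noteq> 0"
        using d(2) unfolding nilpotent_map_def by blast
      then have "(D ^^ (n + 1)) (f z) \<noteq> 0"
        using D_pow[of z "n + 1"] f0 by metis
      then show ?thesis
        using fV z(1) by blast
    qed
  qed (use assms in auto)
  then show "\<exists>j\<in>{3..n}. alg_iso scale L br coord_scale ?V (F2j_br n j)"
    using alg_iso_trans assms(5,6) by blast
next
  fix i j
  assume "i \<in> {3..n}" "j \<in> {3..n}" "i \<noteq> j"
  then show "\<not> alg_iso coord_scale (coord_space n) (F2j_br n i) coord_scale (coord_space n) (F2j_br n j)"
    by (rule F2j_not_alg_iso[OF assms(1)])
qed

end
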